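(* For each integer $n\ge 1$, $$\prod_{i=1}^{n}L_i(x)=U_{2^n-1}\!\left(\frac{x^2}{2}-1\right).$$
   Context: The Lucas-Lehmer polynomials $L_n$ are defined by $L_0(x)=x$ and $L_n(x)=L_{n-1}(x)^2-2$ for $n\ge 1$. The Chebyshev polynomials of the second kind $U_n$ are defined by $U_0(x)=1$, $U_1(x)=2x$, and $U_n(x)=2xU_{n-1}(x)-U_{n-2}(x)$ for $n\ge 2$. *)

theory Defs
  imports "HOL-Computational_Algebra.Polynomial"
begin

fun Lucas_Lehmer_poly :: "nat \<Rightarrow> real poly" where
  "Lucas_Lehmer_poly 0 = [:0, 1:]"
| "Lucas_Lehmer_poly (Suc n) = (Lucas_Lehmer_poly n)\<^sup>2 - 2"

fun Chebyshev_U :: "nat \<Rightarrow> real poly" where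
  "Chebyshev_U 0 = 1"
| "Chebyshev_U (Suc 0) = [:0, 2:]"
| "Chebyshev_U (Suc (Suc n)) = [:0, 2:] * Chebyshev_U (Suc n) - Chebyshev_U n"

end

theory Submission
  imports Defs
begin

text \<open>
  Both sides are built by doubling. Let \<open>T\<^sub>k\<close> be the Chebyshev polynomials of the first kind.
  The identities \<open>sin (2a) = 2 sin a cos a\<close> and \<open>2 cos (2a) = (2 cos a)\<^sup>2 - 2\<close> become
  \<open>U\<^bsub>2k-1\<^esub> = U\<^bsub>k-1\<^esub> \<cdot> 2T\<^sub>k\<close> and \<open>2T\<^bsub>2k\<^esub> = (2T\<^sub>k)\<^sup>2 - 2\<close>. The second is the Lucas-Lehmer
  recursion; since \<open>2T\<^sub>1(x\<^sup>2/2 - 1) = x\<^sup>2 - 2 = L\<^sub>1(x)\<close>, it gives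
  \<open>L\<^bsub>n+1\<^esub>(x) = 2T\<^bsub>2^n\<^esub>(x\<^sup>2/2 - 1)\<close>. The first then says that passing from \<open>U\<^bsub>2^n-1\<^esub>\<close> to
  \<open>U\<^bsub>2^(n+1)-1\<^esub>\<close> multiplies by exactly the next factor \<open>L\<^bsub>n+1\<^esub>\<close> of the product.

  The identities are proved inside the sequence \<open>U\<close> alone, by writing
  \<open>2T\<^bsub>k+1\<^esub> = 2U\<^bsub>k+1\<^esub> - 2xU\<^sub>k\<close>; the role of \<open>sin\<^sup>2 + cos\<^sup>2 = 1\<close> is played by the
  quadratic relation \<open>Chebyshev_U_quadratic_relation\<close> between consecutive terms.
\<close>

text \<open>
  Twice the Chebyshev polynomial of the first kind of index \<open>k + 1\<close>. The shift keeps the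
  indices of \<open>U\<close> natural: \<open>U\<close> of index \<open>k\<close> corresponds to the angle multiple \<open>k + 1\<close>.
\<close>
definition twice_Chebyshev_T_Suc :: "nat \<Rightarrow> real poly" where
  "twice_Chebyshev_T_Suc k = 2 * Chebyshev_U (Suc k) - [:0, 2:] * Chebyshev_U k"

text \<open>
  The quadratic form \<open>v\<^sup>2 - t v w + w\<^sup>2\<close> is invariant under the recurrence step
  \<open>(w, v) \<mapsto> (v, t v - w)\<close>.
\<close>
lemma Chebyshev_U_quadratic_relation:
  "(Chebyshev_U (Suc k))\<^sup>2 - [:0, 2:] * Chebyshev_U (Suc k) * Chebyshev_U k + (Chebyshev_U k)\<^sup>2 = 1"
proof (induction k)
  case 0
  show ?case by (simp add: power2_eq_square)
next
  case (Suc k)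
  have "(t * v - w)\<^sup>2 - t * (t * v - w) * v + v\<^sup>2 = v\<^sup>2 - t * v * w + w\<^sup>2" for t v w :: "real poly"
    by algebra
  from this[of "[:0, 2:]" "Chebyshev_U (Suc k)" "Chebyshev_U k"] show ?case
    using Suc.IH by (simp only: Chebyshev_U.simps)
qed

text \<open>
  The two formulas support each other in the induction, as the recurrence links three
  consecutive indices.
\<close>
lemma Chebyshev_U_double:
  shows Chebyshev_U_double_odd:
      "Chebyshev_U (Suc (2 * k)) = Chebyshev_U k * twice_Chebyshev_T_Suc k"
    and Chebyshev_U_double_even:
      "Chebyshev_U (Suc (Suc (2 * k))) = (Chebyshev_U (Suc k))\<^sup>2 - (Chebyshev_U k)\<^sup>2"
proof (induction k)
  case 0
  show "Chebyshev_U (Suc (2 * 0)) = Chebyshev_U 0 * twice_Chebyshev_T_Suc 0"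
    by (simp add: twice_Chebyshev_T_Suc_def algebra_simps numeral_poly)
  show "Chebyshev_U (Suc (Suc (2 * 0))) = (Chebyshev_U (Suc 0))\<^sup>2 - (Chebyshev_U 0)\<^sup>2"
    by (simp add: power2_eq_square)
next
  case (Suc k)
  define t :: "real poly" where "t = [:0, 2:]"
  define v where "v = Chebyshev_U (Suc k)"
  define w where "w = Chebyshev_U k"
  have step: "Chebyshev_U (Suc (Suc j)) = t * Chebyshev_U (Suc j) - Chebyshev_U j" for j
    by (simp only: Chebyshev_U.simps t_def)
  have odd: "Chebyshev_U (Suc (2 * k)) = w * (2 * v - t * w)"
    and even: "Chebyshev_U (Suc (Suc (2 * k))) = v\<^sup>2 - w\<^sup>2"
    using Suc.IH by (simp_all only: twice_Chebyshev_T_Suc_def t_def v_def w_def)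
  have next_v: "Chebyshev_U (Suc (Suc k)) = t * v - w"
    by (simp only: step v_def w_def)
  have next_odd: "Chebyshev_U (Suc (2 * Suc k)) = t * (v\<^sup>2 - w\<^sup>2) - w * (2 * v - t * w)"
    using step[of "Suc (2 * k)"] by (simp only: odd even mult_Suc_right add_2_eq_Suc)
  show "Chebyshev_U (Suc (2 * Suc k)) = Chebyshev_U (Suc k) * twice_Chebyshev_T_Suc (Suc k)"
    unfolding next_odd twice_Chebyshev_T_Suc_def next_v
    unfolding t_def[symmetric] v_def[symmetric] by algebra
  have "Chebyshev_U (Suc (Suc (2 * Suc k))) = t * Chebyshev_U (Suc (2 * Suc k)) - (v\<^sup>2 - w\<^sup>2)"
    using step[of "2 * Suc k"] by (simp only: even mult_Suc_right add_2_eq_Suc)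
  then show "Chebyshev_U (Suc (Suc (2 * Suc k))) = (Chebyshev_U (Suc (Suc k)))\<^sup>2 - (Chebyshev_U (Suc k))\<^sup>2"
    unfolding next_odd next_v v_def[symmetric] by algebra
qed

lemma twice_Chebyshev_T_Suc_double:
  "twice_Chebyshev_T_Suc (Suc (2 * k)) = (twice_Chebyshev_T_Suc k)\<^sup>2 - 2"
proof -
  have "2 * (v\<^sup>2 - w\<^sup>2) - t * (w * (2 * v - t * w)) = (2 * v - t * w)\<^sup>2 - 2"
    if "v\<^sup>2 - t * v * w + w\<^sup>2 = 1" for t v w :: "real poly"
    using that by algebra
  from this[OF Chebyshev_U_quadratic_relation[of k]] show ?thesis
    by (simp only: twice_Chebyshev_T_Suc_def[of "Suc (2 * k)"] Chebyshev_U_double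
        twice_Chebyshev_T_Suc_def[of k])
qed

lemma two_power_Suc_minus_1: "2 ^ Suc n - 1 = Suc (2 * (2 ^ n - 1 :: nat))"
  unfolding power_Suc using one_le_power[of "2 :: nat" n] by linarith

lemma Lucas_Lehmer_poly_Suc_eq_twice_Chebyshev_T:
  "Lucas_Lehmer_poly (Suc n) = twice_Chebyshev_T_Suc (2 ^ n - 1) \<circ>\<^sub>p [:-1, 0, 1/2:]"
proof (induction n)
  case 0
  show ?case
    by (simp add: twice_Chebyshev_T_Suc_def power2_eq_square pcompose_pCons pcompose_diff numeral_poly)
next
  case (Suc n)
  have "Lucas_Lehmer_poly (Suc (Suc n))
      = ((twice_Chebyshev_T_Suc (2 ^ n - 1))\<^sup>2 - 2) \<circ>\<^sub>p [:-1, 0, 1/2:]"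
    by (simp only: Lucas_Lehmer_poly.simps(2)[of "Suc n"] Suc.IH power2_eq_square
        pcompose_diff pcompose_mult) (simp add: numeral_poly)
  then show ?case
    by (simp only: two_power_Suc_minus_1 twice_Chebyshev_T_Suc_double)
qed

theorem proposition12:
  fixes n :: nat
  assumes "n \<ge> 1"
  shows "(\<Prod>i = 1..n. Lucas_Lehmer_poly i) = Chebyshev_U (2 ^ n - 1) \<circ>\<^sub>p [:-1, 0, 1/2:]"
proof (induction n)
  case 0
  show ?case by (simp add: pcompose_1)
next
  case (Suc n)
  have "(\<Prod>i = 1..Suc n. Lucas_Lehmer_poly i)
      = (\<Prod>i = 1..n. Lucas_Lehmer_poly i) * Lucas_Lehmer_poly (Suc n)"
    by simp
  also have "\<dots> = (Chebyshev_U (2 ^ n - 1) * twice_Chebyshev_T_Suc (2 ^ n - 1)) \<circ>\<^sub>p [:-1, 0, 1/2:]"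
    by (simp only: Suc.IH Lucas_Lehmer_poly_Suc_eq_twice_Chebyshev_T pcompose_mult)
  also have "\<dots> = Chebyshev_U (2 ^ Suc n - 1) \<circ>\<^sub>p [:-1, 0, 1/2:]"
    by (simp only: two_power_Suc_minus_1 Chebyshev_U_double_odd)
  finally show ?case .
qed

end
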